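(* Let $k\in[0,1)$ and let $S$ be a weakly regular AG-groupoid with left identity $e$. Then the following conditions are equivalent: (i) $S$ is regular. (ii) $f\wedge_k g=(f\circ_k g)\circ_k f$ for every $(\in,\in\vee q_k)$-fuzzy quasi-ideal $f$ and every $(\in,\in\vee q_k)$-fuzzy ideal $g$ of $S$. (iii) $f\wedge_k g=(f\circ_k g)\circ_k f$ for every $(\in,\in\vee q_k)$-fuzzy quasi-ideal $f$ and every $(\in,\in\vee q_k)$-fuzzy interior ideal $g$ of $S$. (iv) $f\wedge_k g=(f\circ_k g)\circ_k f$ for every $(\in,\in\vee q_k)$-fuzzy bi-ideal $f$ and every $(\in,\in\vee q_k)$-fuzzy ideal $g$ of $S$. (v) $f\wedge_k g=(f\circ_k g)\circ_k f$ for every $(\in,\in\vee q_k)$-fuzzy bi-ideal $f$ and every $(\in,\in\vee q_k)$-fuzzy interior ideal $g$ of $S$. (vi) $f\wedge_k g=(f\circ_k g)\circ_k f$ for every $(\in,\in\vee q_k)$-fuzzy generalized bi-ideal $f$ and every $(\in,\in\vee q_k)$-fuzzy ideal $g$ of $S$. (vii) $f\wedge_k g=(f\circ_k g)\circ_k f$ for every $(\in,\in\vee q_k)$-fuzzy generalized bi-ideal $f$ and every $(\in,\in\vee q_k)$-fuzzy interior ideal $g$ of $S$.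
   Context: An AG-groupoid is a (non-empty) set $S$ with a binary operation satisfying $(ab)c=(cb)a$ for all $a,b,c\in S$. A left identity is an element $e$ with $ea=a$ for all $a$. $S$ is weakly regular if for each $a\in S$ there are $x,y\in S$ with $a=(ax)(ay)$; $S$ is regular if for each $a\in S$ there is $x\in S$ with $a=(ax)a$. A fuzzy subset of $S$ is a map $f:S\to[0,1]$; $\wedge$ denotes minimum. $1$ denotes the constant fuzzy subset with value $1$. The product is $(f\circ g)(a)=\sup_{a=bc}\, (f(b)\wedge g(c))$ (supremum over all $b,c\in S$ with $a=bc$), and $(f\circ g)(a)=0$ if $a$ is not a product of two elements. Further, $(f\wedge_k g)(a)=f(a)\wedge g(a)\wedge\frac{1-k}{2}$ and $(f\circ_k g)(a)=(f\circ g)(a)\wedge\frac{1-k}{2}$. For $x\in S$, $t\in(0,1]$: $x_t\in f$ means $f(x)\ge t$; $x_t q_k f$ means $f(x)+t+k>1$; $x_t\in\vee q_k f$ means $x_t\in f$ or $x_tq_kf$. A fuzzy subset $f$ is an $(\in,\in\vee q_k)$-fuzzy: - left (right) ideal if $y_t\in f$ implies $(xy)_t\in\vee q_k f$ (respectively $(yx)_t\in\vee q_kf$) for all $x,y\in S$, $t\in(0,1]$; equivalently $f(xy)\ge f(y)\wedge\frac{1-k}{2}$ (respectively $f(xy)\ge f(x)\wedge\frac{1-k}{2}$) for all $x,y$; an ideal (two-sided ideal) if it is both a left and a right one; - subgroupoid if $x_t\in f$ and $y_r\in f$ imply $(xy)_{t\wedge r}\in\vee q_kf$; equivalently $f(xy)\ge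 f(x)\wedge f(y)\wedge\frac{1-k}{2}$ for all $x,y$; - generalized bi-ideal if $x_t\in f$ and $z_r\in f$ imply $((xy)z)_{t\wedge r}\in\vee q_kf$ for all $y$; equivalently $f((xy)z)\ge f(x)\wedge f(z)\wedge\frac{1-k}{2}$ for all $x,y,z$; - bi-ideal if it is both an $(\in,\in\vee q_k)$-fuzzy subgroupoid and an $(\in,\in\vee q_k)$-fuzzy generalized bi-ideal; - interior ideal if it is an $(\in,\in\vee q_k)$-fuzzy subgroupoid and $y_t\in f$ implies $((xy)z)_t\in\vee q_kf$ for all $x,z$; equivalently, a subgroupoid with $f((xy)z)\ge f(y)\wedge\frac{1-k}{2}$ for all $x,y,z$; - quasi-ideal if $f(x)\ge (f\circ 1)(x)\wedge(1\circ f)(x)\wedge\frac{1-k}{2}$ for all $x$. *)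

theory Defs
  imports Complex_Main
begin

(* The underlying (non-empty) set of the groupoid is the whole type 'a. *)

definition ag_groupoid :: "('a \<Rightarrow> 'a \<Rightarrow> 'a) \<Rightarrow> bool" where
  "ag_groupoid m \<longleftrightarrow> (\<forall>a b c. m (m a b) c = m (m c b) a)"

definition left_identity :: "('a \<Rightarrow> 'a \<Rightarrow> 'a) \<Rightarrow> 'a \<Rightarrow> bool" where
  "left_identity m e \<longleftrightarrow> (\<forall>a. m e a = a)"

definition weakly_regular :: "('a \<Rightarrow> 'a \<Rightarrow> 'a) \<Rightarrow> bool" where
  "weakly_regular m \<longleftrightarrow> (\<forall>a. \<exists>x y. a = m (m a x) (m a y))"

definition regular :: "('a \<Rightarrow> 'a \<Rightarrow> 'a) \<Rightarrow> bool" where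
  "regular m \<longleftrightarrow> (\<forall>a. \<exists>x. a = m (m a x) a)"

definition fuzzy_subset :: "('a \<Rightarrow> real) \<Rightarrow> bool" where
  "fuzzy_subset f \<longleftrightarrow> (\<forall>x. 0 \<le> f x \<and> f x \<le> 1)"

(* For fuzzy subsets f and g the set below is bounded by 1, so Sup is the true supremum
   whenever a is a product; Sup {} is unspecified on the reals, hence the case distinction. *)
definition fuzzy_prod ::
  "('a \<Rightarrow> 'a \<Rightarrow> 'a) \<Rightarrow> ('a \<Rightarrow> real) \<Rightarrow> ('a \<Rightarrow> real) \<Rightarrow> 'a \<Rightarrow> real" where
  "fuzzy_prod m f g a =
     (if \<exists>b c. a = m b c then Sup {min (f b) (g c) | b c. a = m b c} else 0)"

definition fuzzy_meet_k :: "real \<Rightarrow> ('a \<Rightarrow> real) \<Rightarrow> ('a \<Rightarrow> real) \<Rightarrow> 'a \<Rightarrow> real" where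
  "fuzzy_meet_k k f g a = min (min (f a) (g a)) ((1 - k) / 2)"

definition fuzzy_prod_k ::
  "('a \<Rightarrow> 'a \<Rightarrow> 'a) \<Rightarrow> real \<Rightarrow> ('a \<Rightarrow> real) \<Rightarrow> ('a \<Rightarrow> real) \<Rightarrow> 'a \<Rightarrow> real" where
  "fuzzy_prod_k m k f g a = min (fuzzy_prod m f g a) ((1 - k) / 2)"

(* The fuzzy point x_t belongs to f, resp. is k-quasi-coincident with f. *)

definition point_in :: "'a \<Rightarrow> real \<Rightarrow> ('a \<Rightarrow> real) \<Rightarrow> bool" where
  "point_in x t f \<longleftrightarrow> f x \<ge> t"

definition point_q :: "real \<Rightarrow> 'a \<Rightarrow> real \<Rightarrow> ('a \<Rightarrow> real) \<Rightarrow> bool" where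
  "point_q k x t f \<longleftrightarrow> f x + t + k > 1"

definition point_in_or_q :: "real \<Rightarrow> 'a \<Rightarrow> real \<Rightarrow> ('a \<Rightarrow> real) \<Rightarrow> bool" where
  "point_in_or_q k x t f \<longleftrightarrow> point_in x t f \<or> point_q k x t f"

definition fuzzy_left_ideal :: "('a \<Rightarrow> 'a \<Rightarrow> 'a) \<Rightarrow> real \<Rightarrow> ('a \<Rightarrow> real) \<Rightarrow> bool" where
  "fuzzy_left_ideal m k f \<longleftrightarrow> fuzzy_subset f \<and>
     (\<forall>x y. \<forall>t\<in>{0<..1}. point_in y t f \<longrightarrow> point_in_or_q k (m x y) t f)"

definition fuzzy_right_ideal :: "('a \<Rightarrow> 'a \<Rightarrow> 'a) \<Rightarrow> real \<Rightarrow> ('a \<Rightarrow> real) \<Rightarrow> bool" where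
  "fuzzy_right_ideal m k f \<longleftrightarrow> fuzzy_subset f \<and>
     (\<forall>x y. \<forall>t\<in>{0<..1}. point_in y t f \<longrightarrow> point_in_or_q k (m y x) t f)"

definition fuzzy_ideal :: "('a \<Rightarrow> 'a \<Rightarrow> 'a) \<Rightarrow> real \<Rightarrow> ('a \<Rightarrow> real) \<Rightarrow> bool" where
  "fuzzy_ideal m k f \<longleftrightarrow> fuzzy_left_ideal m k f \<and> fuzzy_right_ideal m k f"

definition fuzzy_subgroupoid :: "('a \<Rightarrow> 'a \<Rightarrow> 'a) \<Rightarrow> real \<Rightarrow> ('a \<Rightarrow> real) \<Rightarrow> bool" where
  "fuzzy_subgroupoid m k f \<longleftrightarrow> fuzzy_subset f \<and>
     (\<forall>x y. \<forall>t\<in>{0<..1}. \<forall>r\<in>{0<..1}.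
        point_in x t f \<longrightarrow> point_in y r f \<longrightarrow> point_in_or_q k (m x y) (min t r) f)"

definition fuzzy_generalized_bi_ideal ::
  "('a \<Rightarrow> 'a \<Rightarrow> 'a) \<Rightarrow> real \<Rightarrow> ('a \<Rightarrow> real) \<Rightarrow> bool" where
  "fuzzy_generalized_bi_ideal m k f \<longleftrightarrow> fuzzy_subset f \<and>
     (\<forall>x y z. \<forall>t\<in>{0<..1}. \<forall>r\<in>{0<..1}.
        point_in x t f \<longrightarrow> point_in z r f \<longrightarrow>
        point_in_or_q k (m (m x y) z) (min t r) f)"

definition fuzzy_bi_ideal :: "('a \<Rightarrow> 'a \<Rightarrow> 'a) \<Rightarrow> real \<Rightarrow> ('a \<Rightarrow> real) \<Rightarrow> bool" where
  "fuzzy_bi_ideal m k f \<longleftrightarrow>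
     fuzzy_subgroupoid m k f \<and> fuzzy_generalized_bi_ideal m k f"

definition fuzzy_interior_ideal :: "('a \<Rightarrow> 'a \<Rightarrow> 'a) \<Rightarrow> real \<Rightarrow> ('a \<Rightarrow> real) \<Rightarrow> bool" where
  "fuzzy_interior_ideal m k f \<longleftrightarrow> fuzzy_subgroupoid m k f \<and>
     (\<forall>x y z. \<forall>t\<in>{0<..1}.
        point_in y t f \<longrightarrow> point_in_or_q k (m (m x y) z) t f)"

definition fuzzy_quasi_ideal :: "('a \<Rightarrow> 'a \<Rightarrow> 'a) \<Rightarrow> real \<Rightarrow> ('a \<Rightarrow> real) \<Rightarrow> bool" where
  "fuzzy_quasi_ideal m k f \<longleftrightarrow> fuzzy_subset f \<and>
     (\<forall>x. f x \<ge> min (min (fuzzy_prod m f (\<lambda>_. 1) x) (fuzzy_prod m (\<lambda>_. 1) f x))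
                     ((1 - k) / 2))"

end

theory Submission
  imports Defs
begin

text \<open>
  With a left identity, weak regularity already implies regularity: writing \<open>a = (a a) u\<close>,
  every product \<open>v a\<close> equals \<open>a ((u v) a)\<close>, so \<open>S a \<subseteq> a S\<close>, while \<open>a = (u a) a\<close>. Hence each
  of the six conditions simply has to hold. It suffices to treat generalized bi-ideals \<open>f\<close> and
  interior ideals \<open>g\<close>. The inequality \<open>\<ge>\<close> is the threshold form of the two ideal conditions
  evaluated at \<open>(p q) c\<close>; the inequality \<open>\<le>\<close> comes from a decomposition \<open>a = (a q) a\<close> in which
  \<open>q\<close> has the form \<open>(a a) z\<close>, so that \<open>g q\<close> is controlled by \<open>g a\<close>.
\<close>

section \<open>Algebra of weakly regular AG-groupoids with left identity\<close>

locale weakly_regular_ag =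
  fixes m :: "'a \<Rightarrow> 'a \<Rightarrow> 'a" (infixl "\<cdot>" 70) and e :: 'a
  assumes ag: "ag_groupoid m" and left_id: "left_identity m e" and wr: "weakly_regular m"
begin

lemma left_invertive: "a \<cdot> b \<cdot> c = c \<cdot> b \<cdot> a"
  using ag unfolding ag_groupoid_def by blast

lemma e_mult [simp]: "e \<cdot> a = a"
  using left_id unfolding left_identity_def by blast

text \<open>Three uses of the left invertive law: (a b)(c d) = ((c d) b) a = ((b d) c) a = (a c)(b
  d).\<close>

lemma medial: "(a \<cdot> b) \<cdot> (c \<cdot> d) = (a \<cdot> c) \<cdot> (b \<cdot> d)"
  by (metis left_invertive)

lemma left_commute: "a \<cdot> (b \<cdot> c) = b \<cdot> (a \<cdot> c)"
  using medial[of e a b c] by simp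

text \<open>Pull \<open>c\<close> to the front, swap inside (a b) d = (d b) a, and push
  \<open>c\<close> back in.\<close>

lemma paramedial: "(a \<cdot> b) \<cdot> (c \<cdot> d) = (d \<cdot> b) \<cdot> (c \<cdot> a)"
  by (metis left_invertive left_commute)

text \<open>The medial law turns (a x)(a y) into (a a)(x y), so u = x y.\<close>

lemma square_decomp:
  obtains u where "a = (a \<cdot> a) \<cdot> u"
  using wr medial unfolding weakly_regular_def by metis

lemma left_mult_eq:
  assumes "a = (a \<cdot> a) \<cdot> u"
  shows "v \<cdot> a = a \<cdot> ((u \<cdot> v) \<cdot> a)"
proof -
  have "v \<cdot> a = (a \<cdot> a) \<cdot> (v \<cdot> u)"
    using assms left_commute by metis
  \<comment> \<open>The paramedial law gives (u a)(v a), which the medial law regroups.\<close>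
  also have "\<dots> = (u \<cdot> v) \<cdot> (a \<cdot> a)"
    by (metis paramedial medial)
  also have "\<dots> = a \<cdot> ((u \<cdot> v) \<cdot> a)"
    by (rule left_commute)
  finally show ?thesis .
qed

lemma left_mult_as_right_mult:
  obtains w where "v \<cdot> a = a \<cdot> w"
  by (metis square_decomp left_mult_eq)

lemma regular_decomp:
  obtains z where "a = (a \<cdot> ((a \<cdot> a) \<cdot> z)) \<cdot> a"
proof -
  obtain u where u: "a = (a \<cdot> a) \<cdot> u" by (rule square_decomp)
  have "a = (u \<cdot> a) \<cdot> a"
    using u left_invertive by metis
  also have "u \<cdot> a = a \<cdot> ((u \<cdot> u) \<cdot> a)"
    using u by (rule left_mult_eq)
  \<comment> \<open>Replacing the last \<open>a\<close> by (a a) u moves a square to the front, with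
    z = (u u) u. Now \<open>a\<close> is the middle factor of (a a) z, as the interior ideal
    inequality requires.\<close>
  also have "(u \<cdot> u) \<cdot> a = (a \<cdot> a) \<cdot> ((u \<cdot> u) \<cdot> u)"
    using u left_commute by metis
  finally show thesis by (rule that)
qed

lemma regular: "regular m"
  unfolding regular_def using regular_decomp by metis

end

section \<open>Bounds for fuzzy products and threshold forms of the ideal conditions\<close>

lemma fuzzy_prod_ge:
  assumes "\<And>x. f x \<le> 1"
  shows "min (f b) (g c) \<le> fuzzy_prod m f g (m b c)"
proof -
  \<comment> \<open>Bounding \<open>f\<close> alone bounds every minimum, so the real supremum is a
    genuine upper bound.\<close>
  have "bdd_above {min (f b') (g c') | b' c'. m b c = m b' c'}"
    using assms by (auto intro!: bdd_aboveI[of _ 1] simp: min.coboundedI1)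
  then have "min (f b) (g c) \<le> Sup {min (f b') (g c') | b' c'. m b c = m b' c'}"
    by (intro cSup_upper) auto
  then show ?thesis unfolding fuzzy_prod_def by auto
qed

text \<open>The condition 0 \<le> B covers elements that are not products, where the value is 0 by
  convention.\<close>

lemma fuzzy_prod_le:
  assumes "0 \<le> B" and "\<And>b c. a = m b c \<Longrightarrow> min (f b) (g c) \<le> B"
  shows "fuzzy_prod m f g a \<le> B"
proof (cases "\<exists>b c. a = m b c")
  case True
  have "Sup {min (f b) (g c) | b c. a = m b c} \<le> B"
    by (rule cSup_least) (use True assms(2) in auto)
  with True show ?thesis unfolding fuzzy_prod_def by simp
qed (simp add: fuzzy_prod_def assms(1))

lemma point_in_or_q_threshold:
  assumes "k < 1" and "0 \<le> f a" and "s \<le> 1"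
    and "\<And>t. 0 < t \<Longrightarrow> t \<le> 1 \<Longrightarrow> t \<le> s \<Longrightarrow> point_in_or_q k a t f"
  shows "min s ((1 - k) / 2) \<le> f a"
proof (cases "0 < s")
  case True
  \<comment> \<open>At this height t \<le> (1 - k)/2, so the quasi-coincidence alternative gives f a
    > 1 - k - t \<ge> (1 - k)/2.\<close>
  then have "point_in_or_q k a (min s ((1 - k) / 2)) f"
    using assms by (intro assms(4)) auto
  then show ?thesis
    unfolding point_in_or_q_def point_in_def point_q_def
    by (auto simp: min_def field_simps split: if_splits)
qed (use assms(2) in auto)

lemma fuzzy_generalized_bi_ideal_threshold:
  assumes "k < 1" and f: "fuzzy_generalized_bi_ideal m k f"
  shows "min (min (f x) (f z)) ((1 - k) / 2) \<le> f (m (m x y) z)"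
proof (rule point_in_or_q_threshold[where f = f and a = "m (m x y) z", OF assms(1)])
  show "0 \<le> f (m (m x y) z)" "min (f x) (f z) \<le> 1"
    using f unfolding fuzzy_generalized_bi_ideal_def fuzzy_subset_def
    by (auto simp: min.coboundedI1)
  fix t :: real
  assume "0 < t" "t \<le> 1" "t \<le> min (f x) (f z)"
  \<comment> \<open>Both points are taken at the same height \<open>t\<close>.\<close>
  then have "point_in_or_q k (m (m x y) z) (min t t) f"
    using f unfolding fuzzy_generalized_bi_ideal_def point_in_def by force
  then show "point_in_or_q k (m (m x y) z) t f" by simp
qed

lemma fuzzy_interior_ideal_threshold:
  assumes "k < 1" and f: "fuzzy_interior_ideal m k f"
  shows "min (f y) ((1 - k) / 2) \<le> f (m (m x y) z)"
  by (rule point_in_or_q_threshold[where f = f and a = "m (m x y) z", OF assms(1)])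
    (use f in \<open>auto simp: fuzzy_interior_ideal_def fuzzy_subgroupoid_def fuzzy_subset_def point_in_def\<close>)

lemma fuzzy_left_ideal_threshold:
  assumes "k < 1" and f: "fuzzy_left_ideal m k f"
  shows "min (f y) ((1 - k) / 2) \<le> f (m x y)"
  by (rule point_in_or_q_threshold[where f = f and a = "m x y", OF assms(1)])
    (use f in \<open>auto simp: fuzzy_left_ideal_def fuzzy_subset_def point_in_def\<close>)

lemma fuzzy_right_ideal_threshold:
  assumes "k < 1" and f: "fuzzy_right_ideal m k f"
  shows "min (f x) ((1 - k) / 2) \<le> f (m x y)"
  by (rule point_in_or_q_threshold[where f = f and a = "m x y", OF assms(1)])
    (use f in \<open>auto simp: fuzzy_right_ideal_def fuzzy_subset_def point_in_def\<close>)

text \<open>Passing from \<open>y\<close> to x y on the left and then to (x y) z on the right gives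
  ideals the same inequality as interior ideals.\<close>

lemma fuzzy_ideal_threshold:
  assumes "k < 1" and "fuzzy_ideal m k f"
  shows "min (f y) ((1 - k) / 2) \<le> f (m (m x y) z)"
  using fuzzy_left_ideal_threshold[OF assms(1), of m f y x]
    fuzzy_right_ideal_threshold[OF assms(1), of m f "m x y" z] assms(2)
  unfolding fuzzy_ideal_def by auto

section \<open>Quasi-ideals and the product formula\<close>

context weakly_regular_ag
begin

text \<open>The element (x y) z = (z y) x lies in S x, hence in x S, and it also lies in S z. So the
  two products with 1 dominate f x and f z there.\<close>

lemma fuzzy_quasi_ideal_threshold:
  assumes f: "fuzzy_quasi_ideal m k f"
  shows "min (min (f x) (f z)) ((1 - k) / 2) \<le> f (x \<cdot> y \<cdot> z)"
proof -
  have f1: "\<And>a. f a \<le> 1"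
    using f unfolding fuzzy_quasi_ideal_def fuzzy_subset_def by blast
  obtain w where w: "x \<cdot> y \<cdot> z = x \<cdot> w"
    using left_mult_as_right_mult left_invertive by metis
  have "f x \<le> fuzzy_prod m f (\<lambda>_. 1) (x \<cdot> y \<cdot> z)"
    using fuzzy_prod_ge[of f x "\<lambda>_. 1" w m] f1[of x] f1 w by (simp add: min_absorb1)
  moreover have "f z \<le> fuzzy_prod m (\<lambda>_. 1) f (x \<cdot> y \<cdot> z)"
    using fuzzy_prod_ge[of "\<lambda>_. 1" "x \<cdot> y" f z m] f1[of z] by (simp add: min_absorb2)
  moreover have "min (min (fuzzy_prod m f (\<lambda>_. 1) (x \<cdot> y \<cdot> z)) (fuzzy_prod m (\<lambda>_. 1) f (x \<cdot> y \<cdot> z)))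
      ((1 - k) / 2) \<le> f (x \<cdot> y \<cdot> z)"
    using f unfolding fuzzy_quasi_ideal_def by blast
  ultimately show ?thesis by linarith
qed

lemma fuzzy_meet_k_eq_prod_k:
  assumes k: "k < 1" and f: "fuzzy_subset f" and g: "fuzzy_subset g"
    and bi: "\<And>x y z. min (min (f x) (f z)) ((1 - k) / 2) \<le> f (x \<cdot> y \<cdot> z)"
    and int: "\<And>x y z. min (g y) ((1 - k) / 2) \<le> g (x \<cdot> y \<cdot> z)"
  shows "fuzzy_meet_k k f g = fuzzy_prod_k m k (fuzzy_prod_k m k f g) f"
proof (rule ext, rule antisym)
  fix a
  have bounds: "0 \<le> f x" "f x \<le> 1" "0 \<le> g x" "g x \<le> 1" for x
    using f g unfolding fuzzy_subset_def by auto
  \<comment> \<open>The outer product needs a bounded first factor for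
    \<open>fuzzy_prod_ge\<close>.\<close>
  have prod_k_le: "fuzzy_prod_k m k f g x \<le> 1" for x
    unfolding fuzzy_prod_k_def using bounds
    by (intro min.coboundedI1 fuzzy_prod_le) (auto simp: min.coboundedI1)
  obtain z where z: "a = (a \<cdot> ((a \<cdot> a) \<cdot> z)) \<cdot> a" by (rule regular_decomp)
  define q where "q = (a \<cdot> a) \<cdot> z"
  have "min (f a) (g q) \<le> fuzzy_prod m f g (a \<cdot> q)"
    using bounds by (intro fuzzy_prod_ge)
  moreover have "min (g a) ((1 - k) / 2) \<le> g q"
    unfolding q_def by (rule int)
  moreover have "min (fuzzy_prod_k m k f g (a \<cdot> q)) (f a)
      \<le> fuzzy_prod m (fuzzy_prod_k m k f g) f a"
    using fuzzy_prod_ge[of "fuzzy_prod_k m k f g" "a \<cdot> q" f a m] prod_k_le z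
    unfolding q_def by simp
  ultimately show "fuzzy_meet_k k f g a \<le> fuzzy_prod_k m k (fuzzy_prod_k m k f g) f a"
    unfolding fuzzy_meet_k_def fuzzy_prod_k_def by linarith
next
  fix a
  let ?K = "(1 - k) / 2"
  have nonneg: "0 \<le> f x" "0 \<le> g x" "0 \<le> ?K" for x
    using f g k unfolding fuzzy_subset_def by auto
  have "fuzzy_prod m (fuzzy_prod_k m k f g) f a \<le> fuzzy_meet_k k f g a"
  proof (rule fuzzy_prod_le)
    show "0 \<le> fuzzy_meet_k k f g a"
      using nonneg unfolding fuzzy_meet_k_def by simp
    fix b c assume a: "a = b \<cdot> c"
    show "min (fuzzy_prod_k m k f g b) (f c) \<le> fuzzy_meet_k k f g a"
    \<comment> \<open>Assuming the contrary puts f c and the cap strictly above the meet. With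
      \<open>c\<close> fixed, the inner supremum over b = p q can then be bounded by itself:
      \<open>bi\<close> and \<open>int\<close> force f p or g q down to the meet.\<close>
    proof (rule ccontr)
      assume "\<not> ?thesis"
      then have contra: "fuzzy_meet_k k f g a < fuzzy_prod m f g b"
        "fuzzy_meet_k k f g a < f c" "fuzzy_meet_k k f g a < ?K"
        unfolding fuzzy_prod_k_def by linarith+
      have "fuzzy_prod m f g b \<le> fuzzy_meet_k k f g a"
      proof (rule fuzzy_prod_le)
        show "0 \<le> fuzzy_meet_k k f g a"
          using nonneg unfolding fuzzy_meet_k_def by simp
        fix p q assume b: "b = p \<cdot> q"
        show "min (f p) (g q) \<le> fuzzy_meet_k k f g a"
          using bi[of p c q] int[of q p c] contra(2,3)
          unfolding fuzzy_meet_k_def a b by linarith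
      qed
      then show False using contra(1) by linarith
    qed
  qed
  then show "fuzzy_prod_k m k (fuzzy_prod_k m k f g) f a \<le> fuzzy_meet_k k f g a"
    unfolding fuzzy_prod_k_def by simp
qed

end

theorem theorem18:
  fixes m :: "'a \<Rightarrow> 'a \<Rightarrow> 'a" and e :: 'a and k :: real
  assumes "0 \<le> k" and "k < 1"
    and "ag_groupoid m" and "left_identity m e" and "weakly_regular m"
  shows
    "(regular m \<longleftrightarrow>
       (\<forall>f g. fuzzy_quasi_ideal m k f \<longrightarrow> fuzzy_ideal m k g \<longrightarrow>
          fuzzy_meet_k k f g = fuzzy_prod_k m k (fuzzy_prod_k m k f g) f)) \<and>
     (regular m \<longleftrightarrow>
       (\<forall>f g. fuzzy_quasi_ideal m k f \<longrightarrow> fuzzy_interior_ideal m k g \<longrightarrow>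
          fuzzy_meet_k k f g = fuzzy_prod_k m k (fuzzy_prod_k m k f g) f)) \<and>
     (regular m \<longleftrightarrow>
       (\<forall>f g. fuzzy_bi_ideal m k f \<longrightarrow> fuzzy_ideal m k g \<longrightarrow>
          fuzzy_meet_k k f g = fuzzy_prod_k m k (fuzzy_prod_k m k f g) f)) \<and>
     (regular m \<longleftrightarrow>
       (\<forall>f g. fuzzy_bi_ideal m k f \<longrightarrow> fuzzy_interior_ideal m k g \<longrightarrow>
          fuzzy_meet_k k f g = fuzzy_prod_k m k (fuzzy_prod_k m k f g) f)) \<and>
     (regular m \<longleftrightarrow>
       (\<forall>f g. fuzzy_generalized_bi_ideal m k f \<longrightarrow> fuzzy_ideal m k g \<longrightarrow>
          fuzzy_meet_k k f g = fuzzy_prod_k m k (fuzzy_prod_k m k f g) f)) \<and>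
     (regular m \<longleftrightarrow>
       (\<forall>f g. fuzzy_generalized_bi_ideal m k f \<longrightarrow> fuzzy_interior_ideal m k g \<longrightarrow>
          fuzzy_meet_k k f g = fuzzy_prod_k m k (fuzzy_prod_k m k f g) f))"
proof -
  interpret weakly_regular_ag m e
    using assms by unfold_locales
  have bi: "min (min (f x) (f z)) ((1 - k) / 2) \<le> f (m (m x y) z)"
    if "fuzzy_quasi_ideal m k f \<or> fuzzy_bi_ideal m k f \<or> fuzzy_generalized_bi_ideal m k f"
    for f x y z
    using that fuzzy_quasi_ideal_threshold[of k f x z y]
      fuzzy_generalized_bi_ideal_threshold[OF assms(2), of m f x z y]
    unfolding fuzzy_bi_ideal_def by blast
  have int: "min (g y) ((1 - k) / 2) \<le> g (m (m x y) z)"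
    if "fuzzy_ideal m k g \<or> fuzzy_interior_ideal m k g" for g x y z
    using that fuzzy_ideal_threshold[OF assms(2), of m g y x z]
      fuzzy_interior_ideal_threshold[OF assms(2), of m g y x z]
    by blast
  \<comment> \<open>The three kinds of \<open>f\<close> and two kinds of \<open>g\<close> give all
    six conditions at once.\<close>
  have "fuzzy_meet_k k f g = fuzzy_prod_k m k (fuzzy_prod_k m k f g) f"
    if f: "fuzzy_quasi_ideal m k f \<or> fuzzy_bi_ideal m k f \<or> fuzzy_generalized_bi_ideal m k f"
      and g: "fuzzy_ideal m k g \<or> fuzzy_interior_ideal m k g" for f g
  proof (rule fuzzy_meet_k_eq_prod_k[OF assms(2)])
    show "fuzzy_subset f"
      using f unfolding fuzzy_quasi_ideal_def fuzzy_bi_ideal_def fuzzy_generalized_bi_ideal_def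
      by blast
    show "fuzzy_subset g"
      using g unfolding fuzzy_ideal_def fuzzy_left_ideal_def fuzzy_interior_ideal_def
        fuzzy_subgroupoid_def by blast
  qed (rule bi[OF f], rule int[OF g])
  then show ?thesis
    using regular by blast
qed

end
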